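(* Let $n\ge 1$, and let $g\in\Sigma_1^{SL(n,\mathbb{C})}$ be such that $g=\Phi(X)$ for some $X\in\mathfrak{su}(n)$. Then $\det(1+I_kX)\neq 0$ for all $1\le k\le n$, and $$d(g)=\mathrm{diag}\left(\frac{\det(1+I_1X)}{\det(1+X)},\ \frac{\det(1+I_2X)}{\det(1+I_1X)},\ \frac{\det(1+I_3X)}{\det(1+I_2X)},\ \dots,\ \frac{\det(1+I_nX)}{\det(1+I_{n-1}X)}=\frac{\det(1-X)}{\det(1+I_{n-1}X)}\right).$$
   Context: Here $1$ denotes the $n\times n$ identity matrix. For $0\le k\le n$, $I_k$ denotes the $n\times n$ diagonal matrix whose first $k$ diagonal entries are $-1$ and whose remaining $n-k$ diagonal entries are $1$ (so $I_0=1$, $I_n=-1$). $\mathfrak{su}(n)$ is the set of trace-zero skew-Hermitian $n\times n$ complex matrices. The Cayley map is $\Phi:\mathfrak{u}(n)\to\{g\in U(n): -1\notin\mathrm{spec}(g)\}$, $\Phi(X)=(1-X)(1+X)^{-1}$. Let $N^-_{SL}$, $H_{SL}$, $N^+_{SL}$ be the subgroups of $SL(n,\mathbb{C})$ consisting of lower triangular unipotent, diagonal, and upper triangular unipotent matrices, respectively. Put $\Sigma_1^{SL(n,\mathbb{C})}=N^-_{SL}H_{SL}N^+_{SL}$ (the "generic" elements). Every $g\in\Sigma_1^{SL(n,\mathbb{C})}$ factors uniquely as $g=l\,d(g)\,u$ with $l\in N^-_{SL}$, $d(g)\in H_{SL}$, $u\in N^+_{SL}$; this defines the diagonal map $d:\Sigma_1^{SL(n,\mathbb{C})}\to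 H_{SL}$. *)

theory Defs
  imports
    "Jordan_Normal_Form.Determinant"
    "Jordan_Normal_Form.Gauss_Jordan_Elimination"
    "Jordan_Normal_Form.Schur_Decomposition"
begin

definition unitary_algebra :: "nat \<Rightarrow> complex mat set" where
  "unitary_algebra n = {X \<in> carrier_mat n n. mat_adjoint X = - X}"

definition trace_mat :: "'a :: comm_monoid_add mat \<Rightarrow> 'a" where
  "trace_mat A = (\<Sum>i<dim_row A. A $$ (i, i))"

definition special_unitary_algebra :: "nat \<Rightarrow> complex mat set" where
  "special_unitary_algebra n = {X \<in> unitary_algebra n. trace_mat X = 0}"

text \<open>\<open>mat_inverse\<close> is \<open>None\<close> exactly on singular matrices. For \<open>X\<close> in \<open>\<uu>(n)\<close> the matrix
  \<open>1 + X\<close> is invertible, since the spectrum of \<open>X\<close> is purely imaginary; outside \<open>\<uu>(n)\<close> the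
  value of \<open>cayley\<close> is irrelevant.\<close>

definition cayley :: "nat \<Rightarrow> complex mat \<Rightarrow> complex mat" where
  "cayley n X = (1\<^sub>m n - X) * the (mat_inverse (1\<^sub>m n + X))"

definition flip_mat :: "nat \<Rightarrow> nat \<Rightarrow> complex mat" where
  "flip_mat n k = mat_diag n (\<lambda>i. if i < k then - 1 else 1)"

lemma flip_mat_0: "flip_mat n 0 = 1\<^sub>m n"
  by (rule eq_matI) (auto simp: flip_mat_def mat_diag_def)

lemma flip_mat_n: "flip_mat n n = - 1\<^sub>m n"
  by (rule eq_matI) (auto simp: flip_mat_def mat_diag_def)

definition SL :: "nat \<Rightarrow> complex mat set" where
  "SL n = {A \<in> carrier_mat n n. det A = 1}"

definition unipotent :: "nat \<Rightarrow> complex mat \<Rightarrow> bool" where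
  "unipotent n A \<longleftrightarrow> A \<in> carrier_mat n n \<and> (\<exists>m. (A - 1\<^sub>m n) ^\<^sub>m m = 0\<^sub>m n n)"

definition SL_lower_unipotent :: "nat \<Rightarrow> complex mat set" where
  "SL_lower_unipotent n = {A \<in> SL n. upper_triangular (transpose_mat A) \<and> unipotent n A}"

definition SL_diagonal :: "nat \<Rightarrow> complex mat set" where
  "SL_diagonal n = {A \<in> SL n. diagonal_mat A}"

definition SL_upper_unipotent :: "nat \<Rightarrow> complex mat set" where
  "SL_upper_unipotent n = {A \<in> SL n. upper_triangular A \<and> unipotent n A}"

definition SL_generic :: "nat \<Rightarrow> complex mat set" where
  "SL_generic n =
    {l * h * u | l h u. l \<in> SL_lower_unipotent n \<and> h \<in> SL_diagonal n \<and> u \<in> SL_upper_unipotent n}"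

text \<open>The diagonal factor is unique for \<open>g\<close> in \<open>SL_generic n\<close>; elsewhere the definite description
  is unspecified.\<close>

definition diag_factor :: "nat \<Rightarrow> complex mat \<Rightarrow> complex mat" where
  "diag_factor n g =
    (THE h. h \<in> SL_diagonal n \<and>
      (\<exists>l \<in> SL_lower_unipotent n. \<exists>u \<in> SL_upper_unipotent n. g = l * h * u))"

end

theory Submission
  imports Defs
begin

text \<open>
  Write \<open>D = 1 + X\<close>, so that \<open>g D = 1 - X\<close>. The first \<open>k\<close> rows of \<open>1 + I\<^sub>k X\<close> are those of
  \<open>1 - X = g D\<close> and the others are those of \<open>D\<close>. Hence \<open>1 + I\<^sub>k X = g\<^sub>k D\<close>, where \<open>g\<^sub>k\<close> is \<open>g\<close> with
  all rows but the first \<open>k\<close> replaced by those of the identity, and \<open>det (1 + I\<^sub>k X) / det (1 + X)\<close>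
  is the \<open>k\<close>-th leading principal minor of \<open>g\<close>. For \<open>g = l h u\<close> this minor is the product of the
  first \<open>k\<close> diagonal entries of \<open>h\<close>, and consecutive quotients recover \<open>h\<close>.
\<close>

text \<open>Padding with identity rows, instead of cutting out the upper left block, keeps every
  matrix of size n, so that products and \<open>det_mult\<close> stay available. For k \<le> n the
  determinant of the padded matrix is still the k-th leading principal minor.\<close>

definition first_rows :: "nat \<Rightarrow> nat \<Rightarrow> 'a :: {zero,one} mat \<Rightarrow> 'a mat" where
  "first_rows n k A = mat n n (\<lambda>(i, j). if i < k then A $$ (i, j) else if i = j then 1 else 0)"

lemma first_rows_carrier [simp]: "first_rows n k A \<in> carrier_mat n n"
  by (simp add: first_rows_def)

lemma first_rows_dim [simp]: "dim_row (first_rows n k A) = n" "dim_col (first_rows n k A) = n"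
  by (simp_all add: first_rows_def)

lemma index_mult_mat_sum:
  assumes "A \<in> carrier_mat n m" "B \<in> carrier_mat m p" "i < n" "j < p"
  shows "(A * B) $$ (i, j) = (\<Sum>r<m. A $$ (i, r) * B $$ (r, j))"
  using assms by (auto simp: scalar_prod_def atLeast0LessThan intro!: sum.cong)

text \<open>Row i of a product depends only on row i of the left factor. This serves both for
  splitting off a triangular factor and for the Cayley equation.\<close>

lemma index_first_rows_mult:
  fixes A B :: "'a :: semiring_1 mat"
  assumes "A \<in> carrier_mat n n" "B \<in> carrier_mat n n" "i < n" "j < n"
  shows "(first_rows n k A * B) $$ (i, j) = (if i < k then (A * B) $$ (i, j) else B $$ (i, j))"
proof (cases "i < k")
  case True
  with assms show ?thesis
    by (simp add: index_mult_mat_sum[of _ n n _ n] del: index_mult_mat)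
      (simp add: first_rows_def)
next
  case False
  with assms have "(first_rows n k A * B) $$ (i, j) = (\<Sum>r<n. if i = r then B $$ (r, j) else 0)"
    by (subst index_mult_mat_sum[of _ n n _ n])
      (auto simp: first_rows_def simp del: sum.delta sum.delta' intro!: sum.cong)
  with False assms show ?thesis
    by (simp del: index_mult_mat)
qed

text \<open>For i < k, row i of \<open>L\<close> is supported in columns up to i, hence below k, so
  it only meets rows of \<open>M\<close> that the truncation leaves intact. The remaining rows are
  identity rows on both sides.\<close>

lemma first_rows_mult_lower_triangular:
  fixes L M :: "'a :: semiring_1 mat"
  assumes L: "L \<in> carrier_mat n n" and M: "M \<in> carrier_mat n n"
    and lower: "upper_triangular (transpose_mat L)"
  shows "first_rows n k (L * M) = first_rows n k L * first_rows n k M"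
proof (rule eq_matI)
  fix i j assume "i < dim_row (first_rows n k L * first_rows n k M)"
    and "j < dim_col (first_rows n k L * first_rows n k M)"
  hence ij: "i < n" "j < n" by simp_all
  show "first_rows n k (L * M) $$ (i, j) = (first_rows n k L * first_rows n k M) $$ (i, j)"
  proof (cases "i < k")
    case True
    have zero: "L $$ (i, r) = 0" if "\<not> r < k" "r < n" for r
      using upper_triangularD[OF lower, of i r] L ij that True by simp
    have "(L * M) $$ (i, j) = (L * first_rows n k M) $$ (i, j)"
      using L M ij
      by (simp add: index_mult_mat_sum[of _ n n _ n] del: index_mult_mat)
        (intro sum.cong refl, auto simp: first_rows_def zero)
    with True ij show ?thesis
      by (simp add: index_first_rows_mult[OF L] del: index_mult_mat) (simp add: first_rows_def)
  next
    case False
    with ij show ?thesis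
      by (simp add: index_first_rows_mult[OF L] del: index_mult_mat) (simp add: first_rows_def)
  qed
qed simp_all

lemma prod_list_diag_mat:
  assumes "A \<in> carrier_mat n n"
  shows "prod_list (diag_mat A) = (\<Prod>i<n. A $$ (i, i))"
  using assms by (simp add: prod_list_diag_prod atLeast0LessThan)

section \<open>Leading minors of triangular matrices\<close>

lemma det_first_rows_upper_triangular:
  fixes A :: "'a :: comm_ring_1 mat"
  assumes A: "A \<in> carrier_mat n n" and upper: "upper_triangular A" and "k \<le> n"
  shows "det (first_rows n k A) = (\<Prod>i<k. A $$ (i, i))"
proof -
  have "upper_triangular (first_rows n k A)"
    using upper_triangularD[OF upper] A by (intro upper_triangularI) (auto simp: first_rows_def)
  hence "det (first_rows n k A) = (\<Prod>i<n. first_rows n k A $$ (i, i))"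
    by (subst det_upper_triangular[of _ n]) (simp_all add: prod_list_diag_mat[of _ n])
  also have "\<dots> = (\<Prod>i<k. A $$ (i, i))"
    using \<open>k \<le> n\<close> by (intro prod.mono_neutral_cong_right) (auto simp: first_rows_def)
  finally show ?thesis .
qed

lemma det_first_rows_lower_triangular:
  fixes A :: "'a :: comm_ring_1 mat"
  assumes A: "A \<in> carrier_mat n n" and lower: "upper_triangular (transpose_mat A)" and "k \<le> n"
  shows "det (first_rows n k A) = (\<Prod>i<k. A $$ (i, i))"
proof -
  have "first_rows n k A $$ (i, j) = 0" if "i < j" "j < n" for i j
    using upper_triangularD[OF lower, of i j] A that by (auto simp: first_rows_def)
  hence "det (first_rows n k A) = (\<Prod>i<n. first_rows n k A $$ (i, i))"
    by (subst det_lower_triangular[of n]) (simp_all add: prod_list_diag_mat[of _ n])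
  also have "\<dots> = (\<Prod>i<k. A $$ (i, i))"
    using \<open>k \<le> n\<close> by (intro prod.mono_neutral_cong_right) (auto simp: first_rows_def)
  finally show ?thesis .
qed

section \<open>Diagonals of triangular and unipotent matrices\<close>

lemma index_mult_upper_triangular:
  fixes A B :: "'a :: semiring_0 mat"
  assumes A: "A \<in> carrier_mat n n" "upper_triangular A"
    and B: "B \<in> carrier_mat n n" "upper_triangular B"
    and ij: "j \<le> i" "i < n"
  shows "(A * B) $$ (i, j) = (if i = j then A $$ (i, i) * B $$ (i, i) else 0)"
proof -
  have "(A * B) $$ (i, j) = (\<Sum>r<n. A $$ (i, r) * B $$ (r, j))"
    using A B ij by (intro index_mult_mat_sum[of _ n n _ n]) auto
  also have "\<dots> = (\<Sum>r<n. if r = i then (if i = j then A $$ (i, i) * B $$ (i, i) else 0) else 0)"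
  proof (intro sum.cong refl)
    \<comment> \<open>If r < i, the entry of \<open>A\<close> vanishes; if r > i, then r > j and the
      entry of \<open>B\<close> vanishes. At r = i the entry of \<open>B\<close> survives only for i
      = j.\<close>
    fix r assume "r \<in> {..<n}"
    then show "A $$ (i, r) * B $$ (r, j) =
        (if r = i then (if i = j then A $$ (i, i) * B $$ (i, i) else 0) else 0)"
      using upper_triangularD[OF A(2), of r i] upper_triangularD[OF B(2), of j r] A(1) B(1) ij
      by (cases r i rule: linorder_cases) auto
  qed
  also have "\<dots> = (if i = j then A $$ (i, i) * B $$ (i, i) else 0)"
    using ij by simp
  finally show ?thesis .
qed

lemma upper_triangular_mult:
  fixes A B :: "'a :: semiring_0 mat"
  assumes "A \<in> carrier_mat n n" "upper_triangular A" "B \<in> carrier_mat n n" "upper_triangular B"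
  shows "upper_triangular (A * B)"
  using assms
  by (intro upper_triangularI) (simp add: index_mult_upper_triangular[of _ n] del: index_mult_mat(1))

lemma upper_triangular_pow:
  fixes A :: "'a :: semiring_1 mat"
  assumes A: "A \<in> carrier_mat n n" "upper_triangular A"
  shows "upper_triangular (A ^\<^sub>m m) \<and> (\<forall>i<n. (A ^\<^sub>m m) $$ (i, i) = (A $$ (i, i)) ^ m)"
proof (induction m)
  case 0
  with A show ?case by simp
next
  case (Suc m)
  have "A ^\<^sub>m m \<in> carrier_mat n n" using A by simp
  with Suc A show ?case
    by (auto simp: upper_triangular_mult[of _ n] index_mult_upper_triangular[of _ n] power_commutes
        simp del: index_mult_mat(1))
qed

text \<open>Unipotence is given as nilpotency of A - 1. For triangular A the diagonal of a power of
  A - 1 consists of powers of \<open>A $$ (i, i) - 1\<close>, which must therefore be 0.\<close>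

lemma unipotent_upper_diag:
  assumes "unipotent n A" "upper_triangular A" "i < n"
  shows "A $$ (i, i) = 1"
proof -
  from assms obtain m where A: "A \<in> carrier_mat n n" and m: "(A - 1\<^sub>m n) ^\<^sub>m m = 0\<^sub>m n n"
    by (auto simp: unipotent_def)
  have B: "A - 1\<^sub>m n \<in> carrier_mat n n" using A by (simp add: minus_carrier_mat)
  have "upper_triangular (A - 1\<^sub>m n)"
    using upper_triangularD[OF assms(2)] A by (intro upper_triangularI) auto
  from upper_triangular_pow[OF B this, of m] m assms(3) A
  have "(A $$ (i, i) - 1) ^ m = 0" by auto
  thus ?thesis by simp
qed

lemma transpose_pow:
  fixes A :: "'a :: comm_semiring_1 mat"
  assumes A: "A \<in> carrier_mat n n"
  shows "transpose_mat (A ^\<^sub>m m) = transpose_mat A ^\<^sub>m m"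
proof (induction m)
  case 0
  with A show ?case by simp
next
  case (Suc m)
  have B: "transpose_mat A \<in> carrier_mat n n" using A by simp
  \<comment> \<open>Powers grow by a factor on the right, but transposition moves that factor to the
    left.\<close>
  have comm: "transpose_mat A * transpose_mat A ^\<^sub>m r = transpose_mat A ^\<^sub>m r * transpose_mat A" for r
  proof (induction r)
    case (Suc r)
    have "transpose_mat A * transpose_mat A ^\<^sub>m Suc r =
        transpose_mat A * transpose_mat A ^\<^sub>m r * transpose_mat A"
      using assoc_mult_mat[OF B pow_carrier_mat[OF B] B] by simp
    with Suc show ?case by simp
  qed (use A in simp)
  show ?case
    using A Suc comm by (simp add: transpose_mult[of _ n n _ n])
qed

text \<open>Reduces the lower unipotent factor to the upper triangular case.\<close>

lemma unipotent_transpose: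
  assumes "unipotent n A"
  shows "unipotent n (transpose_mat A)"
proof -
  from assms obtain m where A: "A \<in> carrier_mat n n" and m: "(A - 1\<^sub>m n) ^\<^sub>m m = 0\<^sub>m n n"
    by (auto simp: unipotent_def)
  have "transpose_mat A - 1\<^sub>m n = transpose_mat (A - 1\<^sub>m n)"
    using A by (intro eq_matI) auto
  hence "(transpose_mat A - 1\<^sub>m n) ^\<^sub>m m = transpose_mat ((A - 1\<^sub>m n) ^\<^sub>m m)"
    using A by (simp add: transpose_pow[of _ n] minus_carrier_mat)
  with A m show ?thesis by (auto simp: unipotent_def)
qed

lemma unipotent_lower_diag:
  assumes "unipotent n A" "upper_triangular (transpose_mat A)" "i < n"
  shows "A $$ (i, i) = 1"
  using unipotent_upper_diag[OF unipotent_transpose[OF assms(1)] assms(2,3)] assms(1,3)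
  by (auto simp: unipotent_def)

lemma det_first_rows_factorization:
  assumes l: "l \<in> SL_lower_unipotent n" and h: "h \<in> SL_diagonal n"
    and u: "u \<in> SL_upper_unipotent n" and k: "k \<le> n"
  shows "det (first_rows n k (l * h * u)) = (\<Prod>i<k. h $$ (i, i))"
proof -
  have l': "l \<in> carrier_mat n n" "upper_triangular (transpose_mat l)" "unipotent n l"
    using l by (auto simp: SL_lower_unipotent_def SL_def)
  have h': "h \<in> carrier_mat n n" "upper_triangular h"
    using h by (auto simp: SL_diagonal_def SL_def diagonal_mat_def)
  have u': "u \<in> carrier_mat n n" "upper_triangular u" "unipotent n u"
    using u by (auto simp: SL_upper_unipotent_def SL_def)
  have hu: "h * u \<in> carrier_mat n n" using h' u' by auto
  have "det (first_rows n k (l * h * u)) = det (first_rows n k l * first_rows n k (h * u))"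
    using first_rows_mult_lower_triangular[OF l'(1) hu l'(2)] l'(1) h'(1) u'(1) by simp
  also have "\<dots> = det (first_rows n k l) * det (first_rows n k (h * u))"
    by (rule det_mult[of _ n]) simp_all
  also have "det (first_rows n k l) = (\<Prod>i<k. l $$ (i, i))"
    by (rule det_first_rows_lower_triangular[OF l'(1,2) k])
  also have "\<dots> = 1"
    using unipotent_lower_diag[OF l'(3,2)] k by (intro prod.neutral) auto
  \<comment> \<open>Only \<open>l\<close> has to be split off: \<open>h * u\<close> is itself upper
    triangular, so its minors are read off its diagonal, which is that of \<open>h\<close>.\<close>
  also have "det (first_rows n k (h * u)) = (\<Prod>i<k. (h * u) $$ (i, i))"
    by (rule det_first_rows_upper_triangular[OF hu upper_triangular_mult[OF h' u'(1,2)] k])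
  also have "\<dots> = (\<Prod>i<k. h $$ (i, i))"
    using unipotent_upper_diag[OF u'(3,2)] k
    by (intro prod.cong refl)
      (simp add: index_mult_upper_triangular[OF h' u'(1,2)] del: index_mult_mat(1))
  finally show ?thesis by simp
qed

lemma SL_diagonal_nonzero:
  assumes "h \<in> SL_diagonal n" "i < n"
  shows "h $$ (i, i) \<noteq> 0"
proof -
  have h: "h \<in> carrier_mat n n" "upper_triangular h" "det h = 1"
    using assms by (auto simp: SL_diagonal_def SL_def diagonal_mat_def)
  hence "(\<Prod>i<n. h $$ (i, i)) = 1"
    by (simp add: det_upper_triangular prod_list_diag_mat)
  with assms(2) show ?thesis
    by (metis finite_lessThan lessThan_iff prod_zero_iff zero_neq_one)
qed

section \<open>The Cayley transform and the determinants of 1 + I_k X\<close>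

lemma det_one_plus_skew_hermitian_nonzero:
  assumes "X \<in> unitary_algebra n"
  shows "det (1\<^sub>m n + X) \<noteq> 0"
proof
  assume det: "det (1\<^sub>m n + X) = 0"
  have X: "X \<in> carrier_mat n n" and adj: "mat_adjoint X = - X"
    using assms by (auto simp: unitary_algebra_def)
  have skew: "cnj (X $$ (j, i)) = - X $$ (i, j)" if "i < n" "j < n" for i j
  proof -
    have "mat_adjoint X $$ (i, j) = (- X) $$ (i, j)" using adj by simp
    thus ?thesis using that X by (simp add: mat_adjoint_def mat_of_rows_def)
  qed
  have "1\<^sub>m n + X \<in> carrier_mat n n" using X by simp
  from det det_0_iff_vec_prod_zero[OF this] obtain v where
    v: "v \<in> carrier_vec n" "v \<noteq> 0\<^sub>v n" "(1\<^sub>m n + X) *\<^sub>v v = 0\<^sub>v n" by auto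
  have "v + X *\<^sub>v v = 0\<^sub>v n"
    using v X add_mult_distrib_mat_vec[of "1\<^sub>m n" n n X v] by simp
  hence "(v + X *\<^sub>v v) $ i = 0" if "i < n" for i
    using that by simp
  hence "v $ i + (\<Sum>j<n. X $$ (i, j) * v $ j) = 0" if "i < n" for i
    using that v X by (simp add: scalar_prod_def atLeast0LessThan)
  hence eig: "(\<Sum>j<n. X $$ (i, j) * v $ j) = - v $ i" if "i < n" for i
    using that by (simp add: add_eq_0_iff)
  \<comment> \<open>For a kernel vector v, so that Xv = -v, \<open>N\<close> is its squared norm and
    \<open>S\<close> is the form v* X v. Applying X to the right-hand v gives S = -N; moving X to
    the other side, with the sign from skewness, gives S = N. Hence v = 0.\<close>
  define N where "N = (\<Sum>i<n. v $ i * cnj (v $ i))"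
  define S where "S = (\<Sum>i<n. cnj (v $ i) * (\<Sum>j<n. X $$ (i, j) * v $ j))"
  have "S = (\<Sum>i<n. cnj (v $ i) * (- v $ i))"
    unfolding S_def by (intro sum.cong refl) (simp add: eig)
  hence S1: "S = - N"
    by (simp add: N_def sum_negf mult.commute)
  have "S = (\<Sum>j<n. \<Sum>i<n. cnj (v $ i) * (X $$ (i, j) * v $ j))"
    unfolding S_def sum_distrib_left by (rule sum.swap)
  also have "\<dots> = (\<Sum>j<n. - v $ j * cnj (\<Sum>i<n. X $$ (j, i) * v $ i))"
    by (auto simp: sum_distrib_left skew intro!: sum.cong)
  also have "\<dots> = N"
    unfolding N_def by (intro sum.cong refl) (simp add: eig)
  finally have "N = 0" using S1 by simp
  moreover have "N = v \<bullet>c v"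
    using v(1) by (simp add: N_def scalar_prod_def atLeast0LessThan)
  ultimately show False
    using v conjugate_square_eq_0_vec[OF v(1)] by simp
qed

text \<open>Clears the inverse from the Cayley transform, leaving an equation that can be compared
  row by row.\<close>

lemma cayley_mult:
  assumes X: "X \<in> carrier_mat n n" and det: "det (1\<^sub>m n + X) \<noteq> 0"
  shows "cayley n X \<in> carrier_mat n n" "cayley n X * (1\<^sub>m n + X) = 1\<^sub>m n - X"
proof -
  have D: "1\<^sub>m n + X \<in> carrier_mat n n" using X by simp
  from det_non_zero_imp_unit[OF D det] mat_inverse(1)[OF D]
  obtain B where "mat_inverse (1\<^sub>m n + X) = Some B" by (metis not_None_eq)
  with mat_inverse(2)[OF D this]
  have B: "B * (1\<^sub>m n + X) = 1\<^sub>m n" "B \<in> carrier_mat n n" "cayley n X = (1\<^sub>m n - X) * B"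
    by (auto simp: cayley_def)
  have E: "1\<^sub>m n - X \<in> carrier_mat n n" using X by (simp add: minus_carrier_mat)
  show "cayley n X \<in> carrier_mat n n" using B E by simp
  show "cayley n X * (1\<^sub>m n + X) = 1\<^sub>m n - X"
    using assoc_mult_mat[OF E B(2) D] right_mult_one_mat[OF E] B by simp
qed

text \<open>The factor det (1 + X) does not depend on k, so it cancels in consecutive quotients and
  leaves quotients of minors of \<open>g\<close>.\<close>

lemma det_flip_mat:
  assumes X: "X \<in> carrier_mat n n" and g: "g \<in> carrier_mat n n"
    and gD: "g * (1\<^sub>m n + X) = 1\<^sub>m n - X"
  shows "det (1\<^sub>m n + flip_mat n k * X) = det (first_rows n k g) * det (1\<^sub>m n + X)"
proof -
  have D: "1\<^sub>m n + X \<in> carrier_mat n n" using X by simp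
  have "1\<^sub>m n + flip_mat n k * X = first_rows n k g * (1\<^sub>m n + X)"
  proof (rule eq_matI)
    fix i j assume "i < dim_row (first_rows n k g * (1\<^sub>m n + X))"
      and "j < dim_col (first_rows n k g * (1\<^sub>m n + X))"
    with X have ij: "i < n" "j < n" by auto
    show "(1\<^sub>m n + flip_mat n k * X) $$ (i, j) = (first_rows n k g * (1\<^sub>m n + X)) $$ (i, j)"
      unfolding index_first_rows_mult[OF g D ij] gD flip_mat_def mat_diag_mult_left[OF X]
      using X ij by simp
  qed (use X in \<open>auto simp: flip_mat_def mat_diag_def\<close>)
  thus ?thesis using det_mult[OF _ D] by simp
qed

section \<open>The diagonal factor\<close>

theorem lemma3p6:
  fixes n :: nat and g X :: "complex mat"
  assumes "n \<ge> 1"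
    and "g \<in> SL_generic n"
    and "X \<in> special_unitary_algebra n"
    and "g = cayley n X"
  shows "(\<forall>k \<in> {1..n}. det (1\<^sub>m n + flip_mat n k * X) \<noteq> 0) \<and>
    diag_factor n g =
      mat_diag n (\<lambda>i. det (1\<^sub>m n + flip_mat n (i + 1) * X) / (if i = 0 then det (1\<^sub>m n + X)
        else det (1\<^sub>m n + flip_mat n i * X))) \<and>
    diag_factor n g $$ (n - 1, n - 1) =
      det (1\<^sub>m n - X) / det (1\<^sub>m n + flip_mat n (n - 1) * X)"
proof -
  have "X \<in> unitary_algebra n"
    using assms(3) by (simp add: special_unitary_algebra_def)
  hence X: "X \<in> carrier_mat n n" and det: "det (1\<^sub>m n + X) \<noteq> 0"
    using det_one_plus_skew_hermitian_nonzero by (auto simp: unitary_algebra_def)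
  define c where "c k = det (1\<^sub>m n + flip_mat n k * X)" for k
  have c0: "c 0 = det (1\<^sub>m n + X)"
    using X by (simp add: c_def flip_mat_0)
  have "- 1\<^sub>m n * X = - X"
    using X by simp
  moreover have "1\<^sub>m n + - X = 1\<^sub>m n - X"
    using X by (intro eq_matI) auto
  ultimately have cn: "c n = det (1\<^sub>m n - X)"
    by (simp add: c_def flip_mat_n)
  \<comment> \<open>Since I_0 = 1, the denominator for i = 0 is \<open>c 0\<close>, and the case
    distinction of the claim becomes one uniform formula.\<close>
  define R where "R = mat_diag n (\<lambda>i. c (i + 1) / c i)"
  \<comment> \<open>The property under the definite description of \<open>diag_factor\<close>. The
    minor formula is derived for every \<open>h\<close> satisfying it, so uniqueness comes with the
    formula.\<close>
  define P where "P h \<longleftrightarrow> h \<in> SL_diagonal n \<and>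
      (\<exists>l \<in> SL_lower_unipotent n. \<exists>u \<in> SL_upper_unipotent n. g = l * h * u)" for h
  have minor: "c k = (\<Prod>i<k. h $$ (i, i)) * c 0" if "P h" "k \<le> n" for h k
    using that det_flip_mat[OF X cayley_mult[OF X det]] assms(4) c0
    by (auto simp: c_def P_def det_first_rows_factorization)
  have nonzero: "c k \<noteq> 0" if "P h" "k \<le> n" for h k
    using minor[OF that] SL_diagonal_nonzero[of h n] that det c0 by (auto simp: P_def)
  have unique: "h = R" if "P h" for h
  proof (rule eq_matI)
    have h: "h \<in> carrier_mat n n" "diagonal_mat h"
      using that by (auto simp: P_def SL_diagonal_def SL_def)
    fix i j assume "i < dim_row R" "j < dim_col R"
    hence ij: "i < n" "j < n" by (auto simp: R_def mat_diag_def)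
    have "c (i + 1) = h $$ (i, i) * c i"
      using minor[OF that, of i] minor[OF that, of "i + 1"] ij by (simp add: mult.commute)
    hence "h $$ (i, i) = c (i + 1) / c i"
      using nonzero[OF that, of i] ij by simp
    thus "h $$ (i, j) = R $$ (i, j)"
      using h ij by (auto simp: R_def mat_diag_def diagonal_mat_def)
  qed (use that in \<open>auto simp: P_def R_def mat_diag_def SL_diagonal_def SL_def\<close>)
  obtain h where h: "P h"
    using assms(2) by (auto simp: SL_generic_def P_def)
  \<comment> \<open>Genericity supplies some factor; as it must equal \<open>R\<close>, membership
    of \<open>R\<close> in \<open>SL_diagonal n\<close> and its factorization come for free.\<close>
  with unique have PR: "P R" by blast
  have "diag_factor n g = R"
    unfolding diag_factor_def P_def[symmetric] using PR unique by (rule the_equality)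
  moreover have "R = mat_diag n (\<lambda>i. c (i + 1) / (if i = 0 then det (1\<^sub>m n + X) else c i))"
    by (simp add: R_def c0[symmetric] if_distrib cong: if_cong) (metis (full_types))
  \<comment> \<open>Subtraction is truncated: n \<ge> 1 makes n - 1 a valid index with successor n,
    so the numerator is \<open>c n\<close>.\<close>
  moreover have "R $$ (n - 1, n - 1) = det (1\<^sub>m n - X) / c (n - 1)"
    using assms(1) by (simp add: R_def mat_diag_def cn)
  moreover have "\<forall>k \<in> {1..n}. c k \<noteq> 0"
    using nonzero[OF h] by simp
  ultimately show ?thesis
    unfolding c_def by simp
qed

end
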